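(* Let $G$ and $H$ be connected graphs with $\mathrm{Aut}(G[H])=\mathrm{Aut}(G)[\mathrm{Aut}(H)]$. Then $$D(H)\leq D(G[H])\leq D(H)+M,$$ where $M=\min\{k : \sum_{m=0}^{k} y_m\geq D(G)\}$ and $$y_m=\begin{cases}1 & m=0,\\ D(H) & m=1,\\ D(H)+\sum_{i=1}^{m-1}\binom{m-1}{i}\binom{D(H)}{i+1} & m\geq 2.\end{cases}$$
   Context: All graphs are finite and simple. For a graph $X$, a vertex labeling $\phi:V(X)\to\{1,\dots,r\}$ is $r$-distinguishing if the only automorphism of $X$ preserving all vertex labels is the identity; the distinguishing number $D(X)$ is the least such $r$. The lexicographic product $G[H]$ has vertex set $V(G)\times V(H)$, with $(a,x)$ adjacent to $(b,y)$ iff $ab\in E(G)$, or $a=b$ and $xy\in E(H)$. The wreath product $\mathrm{Aut}(G)[\mathrm{Aut}(H)]$ is the subgroup of $\mathrm{Aut}(G[H])$ consisting of all maps of the form $(g,h)\mapsto(\alpha g,\beta_{g}h)$, where $\alpha\in\mathrm{Aut}(G)$ and, for each $g\in V(G)$, $\beta_g\in\mathrm{Aut}(H)$. *)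

theory Defs
  imports
    "Graph_Theory.Digraph_Component"
    "HOL-Combinatorics.Permutations"
begin

text \<open>
  A finite simple graph is a \<open>pair_pre_digraph\<close> record satisfying \<open>pair_graph\<close>: a finite,
  symmetric, loop-free relation on a finite vertex set, each edge being present as both arcs.
  Automorphisms are represented by permutations of the ambient type that fix every
  non-vertex, so that equality of automorphisms is equality of functions and the identity
  automorphism is \<open>id\<close>.
\<close>

definition automorphisms :: "'a pair_pre_digraph \<Rightarrow> ('a \<Rightarrow> 'a) set" where
  "automorphisms X =
     {f. f permutes pverts X \<and>
         (\<forall>u\<in>pverts X. \<forall>v\<in>pverts X. (f u, f v) \<in> parcs X \<longleftrightarrow> (u, v) \<in> parcs X)}"

definition distinguishing ::
    "'a pair_pre_digraph \<Rightarrow> nat \<Rightarrow> ('a \<Rightarrow> nat) \<Rightarrow> bool" where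
  "distinguishing X r \<phi> \<longleftrightarrow>
     \<phi> \<in> pverts X \<rightarrow> {1..r} \<and>
     (\<forall>f\<in>automorphisms X. (\<forall>v\<in>pverts X. \<phi> (f v) = \<phi> v) \<longrightarrow> f = id)"

definition distinguishing_number :: "'a pair_pre_digraph \<Rightarrow> nat" where
  "distinguishing_number X = (LEAST r. \<exists>\<phi>. distinguishing X r \<phi>)"

definition lex_product ::
    "'a pair_pre_digraph \<Rightarrow> 'b pair_pre_digraph \<Rightarrow> ('a \<times> 'b) pair_pre_digraph" where
  "lex_product G H =
     \<lparr> pverts = pverts G \<times> pverts H,
       parcs = {((a, x), (b, y)) | a x b y.
                  a \<in> pverts G \<and> x \<in> pverts H \<and> b \<in> pverts G \<and> y \<in> pverts H \<and>
                  ((a, b) \<in> parcs G \<or> a = b \<and> (x, y) \<in> parcs H)} \<rparr>"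

definition wreath_product ::
    "'a pair_pre_digraph \<Rightarrow> 'b pair_pre_digraph \<Rightarrow> ('a \<times> 'b \<Rightarrow> 'a \<times> 'b) set" where
  "wreath_product G H =
     {f \<in> automorphisms (lex_product G H).
        \<exists>\<alpha>\<in>automorphisms G. \<exists>\<beta>\<in>pverts G \<rightarrow> automorphisms H.
          \<forall>g\<in>pverts G. \<forall>h\<in>pverts H. f (g, h) = (\<alpha> g, \<beta> g h)}"

text \<open>The numbers $y_m$, with \<open>d\<close> in the role of $D(H)$.\<close>

definition y_seq :: "nat \<Rightarrow> nat \<Rightarrow> nat" where
  "y_seq d m =
     (if m = 0 then 1
      else if m = 1 then d
      else d + (\<Sum>i = 1..m - 1. ((m - 1) choose i) * (d choose (i + 1))))"

lemma pair_graph_lex_product: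
  assumes "pair_graph G" and "pair_graph H"
  shows "pair_graph (lex_product G H)"
proof -
  interpret G: pair_graph G by (rule assms(1))
  interpret H: pair_graph H by (rule assms(2))
  have sub: "parcs (lex_product G H) \<subseteq> (pverts G \<times> pverts H) \<times> (pverts G \<times> pverts H)"
    by (auto simp: lex_product_def)
  have fin: "finite (parcs (lex_product G H))"
    by (rule finite_subset[OF sub])
      (simp add: G.pair_finite_verts H.pair_finite_verts)
  have sG: "sym (parcs G)" and sH: "sym (parcs H)"
    using G.pair_sym_arcs H.pair_sym_arcs by (simp_all add: symmetric_def)
  have sym: "sym (parcs (lex_product G H))"
    using sG sH by (auto simp: lex_product_def sym_def)
  show ?thesis
    by unfold_locales
      (use fin sym G.pair_no_loops H.pair_no_loops in
        \<open>auto simp: lex_product_def symmetric_def G.pair_finite_verts H.pair_finite_verts\<close>)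
qed

text \<open>The minimum in \<open>distinguishing_number\<close> is attained: use pairwise distinct labels.\<close>

lemma distinguishing_distinguishing_number:
  assumes "finite (pverts X)"
  shows "\<exists>\<phi>. distinguishing X (distinguishing_number X) \<phi>"
proof -
  obtain \<phi> where \<phi>: "bij_betw \<phi> (pverts X) {1..card (pverts X)}"
    using ex_bij_betw_finite_nat[OF assms]
    by (metis assms card_atLeastAtMost diff_Suc_1 finite_atLeastAtMost finite_same_card_bij)
  have "distinguishing X (card (pverts X)) \<phi>"
    unfolding distinguishing_def
  proof (intro conjI ballI impI)
    show "\<phi> \<in> pverts X \<rightarrow> {1..card (pverts X)}"
      using \<phi> by (auto simp: bij_betw_def)
  next
    fix f assume f: "f \<in> automorphisms X" and pres: "\<forall>v\<in>pverts X. \<phi> (f v) = \<phi> v"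
    have perm: "f permutes pverts X" using f by (simp add: automorphisms_def)
    have "f v = v" for v
    proof (cases "v \<in> pverts X")
      case True
      then have "f v \<in> pverts X" using perm by (simp add: permutes_in_image)
      then show ?thesis using True pres \<phi> by (auto simp: bij_betw_def dest: inj_onD)
    next
      case False
      then show ?thesis using perm by (simp add: permutes_def)
    qed
    then show "f = id" by auto
  qed
  then show ?thesis
    unfolding distinguishing_number_def
    by (intro LeastI[where P = "\<lambda>r. \<exists>\<phi>. distinguishing X r \<phi>"]) blast
qed

end

theory Submission
  imports Defs
begin

text \<open>
  Write $d = D(H)$. By Vandermonde's identity $y_m = \binom{d+m-1}{m}$, so
  $\sum_{m \le k} y_m = \binom{d+k}{d}$ counts the $d$-subsets of a palette of $d+k$ labels.
  Hence for $k = M$ distinct $d$-subsets can be assigned to the labels of a distinguishing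
  labeling of $G$, and each copy of $H$ is labeled by a distinguishing labeling with the subset
  of its base vertex. A minimal distinguishing labeling of $H$ uses all $d$ labels, so a
  label-preserving element of the wreath product preserves these subsets; it therefore fixes $G$
  and then each copy of $H$. The lower bound comes from restricting a labeling of $G[H]$ to one
  copy of $H$, as automorphisms of a single copy extend by the identity.
\<close>

section \<open>Binomial form of the numbers $y_m$ and their partial sums\<close>

text \<open>The lower index is the constant \<open>d - 1\<close>, not \<open>m\<close>, so that
  summing over \<open>m\<close> runs along a diagonal of Pascal's triangle. For \<open>d = 0\<close>
  truncated subtraction would make the right side 1 for every \<open>m\<close>.\<close>

lemma y_seq_eq_binomial:
  assumes "d > 0"
  shows "y_seq d m = (d - 1 + m) choose (d - 1)"
proof -
  have main: "y_seq d (Suc n) = (d + n) choose Suc n" for n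
  proof -
    have "(d + n) choose Suc n = (\<Sum>k\<le>Suc n. (d choose k) * (n choose (Suc n - k)))"
      by (rule vandermonde[symmetric])
    \<comment> \<open>The term for \<open>k = 0\<close> vanishes, because
      \<open>n choose Suc n = 0\<close>.\<close>
    also have "\<dots> = (\<Sum>k\<le>n. (d choose Suc k) * (n choose (n - k)))"
      by (subst sum.atMost_Suc_shift) simp
    also have "\<dots> = (\<Sum>i\<le>n. (n choose i) * (d choose Suc i))"
      by (intro sum.cong) (auto simp: binomial_symmetric[symmetric])
    \<comment> \<open>The split-off term for \<open>i = 0\<close> is \<open>d choose 1\<close>. For
      \<open>n = 0\<close> the remaining sum is empty, which matches the separate clause of
      \<open>y_seq\<close> at \<open>m = 1\<close>.\<close>
    also have "\<dots> = d + (\<Sum>i = 1..n. (n choose i) * (d choose Suc i))"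
      by (simp add: atMost_atLeast0 sum.atLeast_Suc_atMost)
    also have "\<dots> = y_seq d (Suc n)"
      by (simp add: y_seq_def)
    finally show ?thesis by simp
  qed
  show ?thesis
  proof (cases m)
    case 0
    then show ?thesis by (simp add: y_seq_def)
  next
    case (Suc n)
    have "(d + n) choose Suc n = (d + n) choose (d - 1)"
      using assms by (subst binomial_symmetric) auto
    then show ?thesis using main[of n] assms Suc by simp
  qed
qed

text \<open>This is the hockey-stick identity with lower index \<open>d - 1\<close>.\<close>

lemma sum_y_seq:
  assumes "d > 0"
  shows "(\<Sum>m = 0..k. y_seq d m) = (d + k) choose d"
  using choose_rising_sum(1)[of "d - 1" k] assms
  by (simp add: y_seq_eq_binomial atMost_atLeast0)

section \<open>Distinguishing labelings with a minimal number of labels\<close>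

lemma automorphismD:
  assumes "f \<in> automorphisms X"
  shows "f permutes pverts X"
    and "\<lbrakk>u \<in> pverts X; v \<in> pverts X\<rbrakk> \<Longrightarrow> (f u, f v) \<in> parcs X \<longleftrightarrow> (u, v) \<in> parcs X"
  using assms by (auto simp: automorphisms_def)

lemma distinguishingD:
  assumes "distinguishing X r \<phi>" "f \<in> automorphisms X"
    and "\<And>v. v \<in> pverts X \<Longrightarrow> \<phi> (f v) = \<phi> v"
  shows "f = id"
  using assms by (auto simp: distinguishing_def)

lemma distinguishing_number_le: "distinguishing X r \<phi> \<Longrightarrow> distinguishing_number X \<le> r"
  unfolding distinguishing_number_def by (rule Least_le) blast

lemma distinguishing_relabel:
  assumes \<phi>: "distinguishing X r \<phi>"
    and b: "inj_on b (\<phi> ` pverts X)" "b ` \<phi> ` pverts X \<subseteq> {1..s}"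
  shows "distinguishing X s (b \<circ> \<phi>)"
  unfolding distinguishing_def
proof (intro conjI ballI impI)
  show "b \<circ> \<phi> \<in> pverts X \<rightarrow> {1..s}" using b(2) by auto
  fix f assume f: "f \<in> automorphisms X" and pres: "\<forall>v\<in>pverts X. (b \<circ> \<phi>) (f v) = (b \<circ> \<phi>) v"
  have "\<phi> (f v) = \<phi> v" if "v \<in> pverts X" for v
    using b(1) pres that permutes_in_image[OF automorphismD(1)[OF f]] by (auto dest: inj_onD)
  then show "f = id" by (rule distinguishingD[OF \<phi> f])
qed

lemma distinguishing_number_labels:
  assumes "finite (pverts X)" "distinguishing X (distinguishing_number X) \<phi>"
  shows "\<phi> ` pverts X = {1..distinguishing_number X}"
proof -
  define S where "S = \<phi> ` pverts X"
  have "finite S" using assms(1) by (simp add: S_def)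
  then obtain b where b: "bij_betw b S {1..card S}"
    by (metis card_atLeastAtMost diff_Suc_1 finite_atLeastAtMost finite_same_card_bij)
  have "distinguishing X (card S) (b \<circ> \<phi>)"
    by (rule distinguishing_relabel[OF assms(2)]) (use b in \<open>auto simp: bij_betw_def S_def\<close>)
  then have "distinguishing_number X \<le> card S"
    by (rule distinguishing_number_le)
  moreover have "S \<subseteq> {1..distinguishing_number X}"
    using assms(2) by (auto simp: S_def distinguishing_def)
  ultimately show ?thesis
    unfolding S_def[symmetric] by (intro card_seteq) auto
qed

lemma distinguishing_number_pos:
  assumes "finite (pverts X)" "pverts X \<noteq> {}"
  shows "distinguishing_number X > 0"
proof -
  obtain \<phi> where "distinguishing X (distinguishing_number X) \<phi>"
    using distinguishing_distinguishing_number[OF assms(1)] by blast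
  from distinguishing_number_labels[OF assms(1) this] assms(2) show ?thesis
    by (cases "distinguishing_number X") auto
qed

section \<open>Lower bound: automorphisms of a single copy of \<open>H\<close>\<close>

definition copy_map :: "'a \<Rightarrow> ('b \<Rightarrow> 'b) \<Rightarrow> 'a \<times> 'b \<Rightarrow> 'a \<times> 'b" where
  "copy_map a f = (\<lambda>(g, h). if g = a then (g, f h) else (g, h))"

text \<open>Adjacency between different copies depends only on the first coordinates, which stay
  fixed; inside the copy over \<open>a\<close> it is adjacency in \<open>H\<close>, which
  \<open>f\<close> preserves.\<close>

lemma copy_map_automorphism:
  assumes "pair_graph G" and a: "a \<in> pverts G" and f: "f \<in> automorphisms H"
  shows "copy_map a f \<in> automorphisms (lex_product G H)"
proof -
  interpret G: pair_graph G by (rule assms(1))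
  note p = automorphismD(1)[OF f]
  have loop: "(a, a) \<notin> parcs G"
    by (rule notI) (drule G.no_loops', simp)
  have "bij (copy_map a f)"
    by (rule bij_betw_byWitness[of _ "copy_map a (inv f)"])
      (auto simp: copy_map_def permutes_inverses[OF p])
  \<comment> \<open>If the first coordinate is \<open>a\<close>, the second lies outside
    \<open>pverts H\<close>, where \<open>f\<close> is the identity.\<close>
  moreover have "copy_map a f x = x" if "x \<notin> pverts G \<times> pverts H" for x
    using that a permutes_not_in[OF p] by (cases x) (auto simp: copy_map_def)
  ultimately have "copy_map a f permutes pverts (lex_product G H)"
    unfolding permutes_def bij_iff lex_product_def by simp
  moreover have "(copy_map a f u, copy_map a f v) \<in> parcs (lex_product G H) \<longleftrightarrow>
      (u, v) \<in> parcs (lex_product G H)"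
    if "u \<in> pverts (lex_product G H)" "v \<in> pverts (lex_product G H)" for u v
    using that loop permutes_in_image[OF p] automorphismD(2)[OF f]
    by (cases u; cases v) (auto simp: copy_map_def lex_product_def)
  ultimately show ?thesis by (auto simp: automorphisms_def)
qed

lemma distinguishing_number_le_lex_product:
  assumes "pair_graph G" "pair_graph H" and a: "a \<in> pverts G"
  shows "distinguishing_number H \<le> distinguishing_number (lex_product G H)"
proof -
  interpret L: pair_graph "lex_product G H"
    by (rule pair_graph_lex_product[OF assms(1,2)])
  obtain \<phi> where \<phi>: "distinguishing (lex_product G H) (distinguishing_number (lex_product G H)) \<phi>"
    using distinguishing_distinguishing_number[OF L.pair_finite_verts] by blast
  have "distinguishing H (distinguishing_number (lex_product G H)) (\<lambda>h. \<phi> (a, h))"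
    unfolding distinguishing_def
  proof (intro conjI ballI impI)
    show "(\<lambda>h. \<phi> (a, h)) \<in> pverts H \<rightarrow> {1..distinguishing_number (lex_product G H)}"
      using \<phi> a by (auto simp: distinguishing_def lex_product_def)
    fix f assume f: "f \<in> automorphisms H" and pres: "\<forall>v\<in>pverts H. \<phi> (a, f v) = \<phi> (a, v)"
    have "copy_map a f = id"
      by (rule distinguishingD[OF \<phi> copy_map_automorphism[OF assms(1) a f]])
        (use pres in \<open>auto simp: copy_map_def lex_product_def\<close>)
    then have "copy_map a f (a, h) = (a, h)" for h by simp
    then show "f = id" by (auto simp: copy_map_def)
  qed
  then show ?thesis by (rule distinguishing_number_le)
qed

section \<open>Upper bound: labeling the copies of \<open>H\<close> by distinct
  \<open>d\<close>-subsets\<close>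

lemma distinguishing_number_lex_product_le:
  assumes "pair_graph G" "pair_graph H"
    and wr: "automorphisms (lex_product G H) = wreath_product G H"
    and k: "distinguishing_number G \<le> (distinguishing_number H + k) choose distinguishing_number H"
  shows "distinguishing_number (lex_product G H) \<le> distinguishing_number H + k"
proof -
  interpret G: pair_graph G by (rule assms(1))
  interpret H: pair_graph H by (rule assms(2))
  define d where "d = distinguishing_number H"
  define P where "P = {S. S \<subseteq> {1..d + k} \<and> card S = d}"
  obtain \<phi> where \<phi>: "distinguishing G (distinguishing_number G) \<phi>"
    using distinguishing_distinguishing_number[OF G.pair_finite_verts] by blast
  obtain \<psi> where \<psi>: "distinguishing H d \<psi>"
    unfolding d_def using distinguishing_distinguishing_number[OF H.pair_finite_verts] by blast
  have \<psi>_im: "\<psi> ` pverts H = {1..d}"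
    using distinguishing_number_labels[OF H.pair_finite_verts] \<psi> by (simp add: d_def)
  have "finite P" by (simp add: P_def)
  moreover have "card {1..distinguishing_number G} \<le> card P"
    using k by (simp add: P_def n_subsets d_def)
  ultimately obtain c where c: "c ` {1..distinguishing_number G} \<subseteq> P"
      "inj_on c {1..distinguishing_number G}"
    using card_le_inj[of "{1..distinguishing_number G}" P] by auto
  \<comment> \<open>Each subset needs a renaming \<open>e S\<close> that carries the labels of
    \<open>\<psi>\<close> to its elements.\<close>
  have "\<exists>e. bij_betw e {1..d} S" if "S \<in> P" for S
    using that finite_subset[of S "{1..d + k}"]
    by (intro finite_same_card_bij) (auto simp: P_def)
  then obtain e where e: "\<And>S. S \<in> P \<Longrightarrow> bij_betw (e S) {1..d} S"
    by metis
  define \<chi> where "\<chi> = (\<lambda>(g, h). e (c (\<phi> g)) (\<psi> h))"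
  have \<phi>_in: "\<phi> g \<in> {1..distinguishing_number G}" if "g \<in> pverts G" for g
    using that \<phi> by (auto simp: distinguishing_def)
  have cP: "c (\<phi> g) \<in> P" if "g \<in> pverts G" for g
    using \<phi>_in[OF that] c(1) by auto
  \<comment> \<open>The subset assigned to \<open>g\<close> can be read off from the labels
    occurring in its copy, since \<open>\<psi>\<close> attains all of \<open>{1..d}\<close>.\<close>
  have copy_labels: "(\<lambda>h. \<chi> (g, h)) ` pverts H = c (\<phi> g)" if "g \<in> pverts G" for g
  proof -
    have "(\<lambda>h. \<chi> (g, h)) ` pverts H = e (c (\<phi> g)) ` \<psi> ` pverts H"
      by (auto simp: \<chi>_def)
    then show ?thesis using e[OF cP[OF that]] by (simp add: \<psi>_im bij_betw_def)
  qed
  have "distinguishing (lex_product G H) (d + k) \<chi>"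
    unfolding distinguishing_def
  proof (intro conjI ballI impI)
    show "\<chi> \<in> pverts (lex_product G H) \<rightarrow> {1..d + k}"
    proof
      fix x assume "x \<in> pverts (lex_product G H)"
      then obtain g h where x: "x = (g, h)" "g \<in> pverts G" "h \<in> pverts H"
        by (auto simp: lex_product_def)
      then have "\<chi> x \<in> c (\<phi> g)" using copy_labels[of g] by auto
      with cP[OF x(2)] show "\<chi> x \<in> {1..d + k}" by (auto simp: P_def)
    qed
  next
    fix f assume f: "f \<in> automorphisms (lex_product G H)"
      and "\<forall>v\<in>pverts (lex_product G H). \<chi> (f v) = \<chi> v"
    then have pres: "\<chi> (f (g, h)) = \<chi> (g, h)" if "g \<in> pverts G" "h \<in> pverts H" for g h
      using that by (auto simp: lex_product_def)
    from f obtain \<alpha> \<beta> where \<alpha>: "\<alpha> \<in> automorphisms G" and \<beta>: "\<beta> \<in> pverts G \<rightarrow> automorphisms H"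
      and f_eq: "\<And>g h. g \<in> pverts G \<Longrightarrow> h \<in> pverts H \<Longrightarrow> f (g, h) = (\<alpha> g, \<beta> g h)"
      unfolding wr by (auto simp: wreath_product_def)
    have \<beta>_perm: "\<beta> g permutes pverts H" if "g \<in> pverts G" for g
      using \<beta> that by (intro automorphismD(1)) auto
    \<comment> \<open>As \<open>f\<close> maps the copy over \<open>g\<close> onto the copy over
      \<open>\<alpha> g\<close> and keeps labels, both copies show the same label set; injectivity
      of \<open>c\<close> then gives equal labels in \<open>G\<close>.\<close>
    have "\<phi> (\<alpha> g) = \<phi> g" if g: "g \<in> pverts G" for g
    proof -
      have \<alpha>g: "\<alpha> g \<in> pverts G"
        using g permutes_in_image[OF automorphismD(1)[OF \<alpha>]] by simp
      have "c (\<phi> (\<alpha> g)) = (\<lambda>h. \<chi> (\<alpha> g, h)) ` pverts H"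
        using copy_labels[OF \<alpha>g] by simp
      also have "\<dots> = (\<lambda>h. \<chi> (\<alpha> g, h)) ` \<beta> g ` pverts H"
        using permutes_image[OF \<beta>_perm[OF g]] by simp
      also have "\<dots> = (\<lambda>h. \<chi> (g, h)) ` pverts H"
        unfolding image_image using pres[OF g] f_eq[OF g] by (intro image_cong) auto
      also have "\<dots> = c (\<phi> g)" by (rule copy_labels[OF g])
      finally show ?thesis
        using c(2) \<phi>_in[OF g] \<phi>_in[OF \<alpha>g] by (auto dest: inj_onD)
    qed
    then have \<alpha>_id: "\<alpha> = id" by (rule distinguishingD[OF \<phi> \<alpha>])
    \<comment> \<open>Once \<open>\<alpha>\<close> is the identity, \<open>f\<close> stays within
      the copy over \<open>g\<close>, so the same renaming occurs on both sides and cancels on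
      \<open>{1..d}\<close>.\<close>
    have \<beta>_id: "\<beta> g = id" if g: "g \<in> pverts G" for g
    proof (rule distinguishingD[OF \<psi>])
      show "\<beta> g \<in> automorphisms H" using \<beta> g by auto
      fix h assume h: "h \<in> pverts H"
      have "\<beta> g h \<in> pverts H" using h permutes_in_image[OF \<beta>_perm[OF g]] by simp
      then have "\<psi> (\<beta> g h) \<in> {1..d}" "\<psi> h \<in> {1..d}" using h \<psi>_im by blast+
      moreover have "e (c (\<phi> g)) (\<psi> (\<beta> g h)) = e (c (\<phi> g)) (\<psi> h)"
        using pres[OF g h] f_eq[OF g h] by (simp add: \<alpha>_id \<chi>_def)
      ultimately show "\<psi> (\<beta> g h) = \<psi> h"
        using e[OF cP[OF g]] by (auto simp: bij_betw_def dest: inj_onD)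
    qed
    show "f = id"
    proof
      fix x
      show "f x = id x"
      proof (cases "x \<in> pverts (lex_product G H)")
        case True
        then show ?thesis using f_eq \<alpha>_id \<beta>_id by (auto simp: lex_product_def)
      next
        case False
        then show ?thesis using permutes_not_in[OF automorphismD(1)[OF f]] by simp
      qed
    qed
  qed
  then show ?thesis unfolding d_def by (rule distinguishing_number_le)
qed

theorem theorem2p2:
  fixes G :: "'a pair_pre_digraph" and H :: "'b pair_pre_digraph"
  assumes "pair_graph G" and "pair_graph H"
    and "Digraph_Component.connected (with_proj G)"
    and "Digraph_Component.connected (with_proj H)"
    and "automorphisms (lex_product G H) = wreath_product G H"
  defines "M \<equiv> (LEAST k. (\<Sum>m = 0..k. y_seq (distinguishing_number H) m)
                           \<ge> distinguishing_number G)"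
  shows "distinguishing_number H \<le> distinguishing_number (lex_product G H) \<and>
         distinguishing_number (lex_product G H) \<le> distinguishing_number H + M"
proof -
  interpret H: pair_graph H by (rule assms(2))
  define d where "d = distinguishing_number H"
  \<comment> \<open>Connectedness includes having a vertex: in \<open>H\<close> this yields
    \<open>d > 0\<close>, in \<open>G\<close> a base vertex for the lower bound.\<close>
  have ne: "pverts G \<noteq> {}" "pverts H \<noteq> {}"
    using assms(3,4) by (auto simp: Digraph_Component.connected_def strongly_connected_def)
  have d: "d > 0"
    unfolding d_def by (rule distinguishing_number_pos[OF H.pair_finite_verts ne(2)])
  \<comment> \<open>The \<open>LEAST\<close> defining \<open>M\<close> is attained: every $y_m$ is
    at least 1, so \<open>k = distinguishing_number G\<close> already satisfies the
    condition.\<close>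
  have "distinguishing_number G \<le> (\<Sum>m = 0..distinguishing_number G. 1)" by simp
  also have "\<dots> \<le> (\<Sum>m = 0..distinguishing_number G. y_seq d m)"
    using d by (intro sum_mono) (simp add: y_seq_eq_binomial Suc_le_eq)
  finally have "(\<Sum>m = 0..M. y_seq d m) \<ge> distinguishing_number G"
    unfolding M_def d_def by (rule LeastI)
  then have "distinguishing_number G \<le> (d + M) choose d"
    by (simp add: sum_y_seq[OF d])
  then show ?thesis
    using distinguishing_number_le_lex_product[OF assms(1,2)] ne
      distinguishing_number_lex_product_le[OF assms(1,2,5)]
    by (auto simp: d_def)
qed

end
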